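(* Let $G$ be an undirected graph on $n$ vertices, with adjacency matrix $A$, and let $\mathcal{O}_h$ $(h=1,2,\dots,t)$ be the $t$ orbitals of edges and nonedges of $G$. Let $m=(m_1,m_2,m_3)$ be such that $m_1+m_2+m_3=n$. Let $(s_1,s_2)$ be an arbitrary edge in the cut graph $G_{m_1,m_2,m_3}$, with adjacency matrix $B$, and for each $h=1,2,\dots,t$ let $(r_{h1},r_{h2})$ be an arbitrary pair of vertices in $\mathcal{O}_h$. Let $\Pi_n(h)$ be the set of matrices $X\in\Pi_n$ such that $X_{r_{h1},s_1}=1$ and $X_{r_{h2},s_2}=1$ $(h=1,2,\dots,t)$. Then $$\min_{X\in\Pi_n}\operatorname{tr}X^{\mathrm T}AXB=\min_{h=1,2,\dots,t}\ \min_{X\in\Pi_n(h)}\operatorname{tr}X^{\mathrm T}AXB.$$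
   Context: $\Pi_n$ is the group of $n\times n$ permutation matrices. The vertices of $G$ are $1,\dots,n$. The orbitals of edges and nonedges of $G$ are the orbits of the automorphism group of $G$ acting on the set of ordered pairs $(x,y)$ of distinct vertices of $G$. The numbers $m_1,m_2,m_3$ are nonnegative integers with $m_1\ge1$ and $m_2\ge1$. The cut graph $G_{m_1,m_2,m_3}$ is the graph on $\{1,\dots,n\}$ with adjacency matrix $$B=\begin{pmatrix} 0_{m_1\times m_1} & J_{m_1\times m_2} & 0_{m_1\times m_3}\\ J_{m_2\times m_1} & 0_{m_2\times m_2} & 0_{m_2\times m_3}\\ 0_{m_3\times m_1} & 0_{m_3\times m_2} & 0_{m_3\times m_3}\end{pmatrix},$$ where $J_{p\times q}$ is the $p\times q$ all-ones matrix. *)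

theory Defs
  imports
    Complex_Main
    "HOL-Combinatorics.Permutations"
    "HOL-Algebra.Group_Action"
    "Graph_Theory.Pair_Digraph"
    "Jordan_Normal_Form.Matrix"
begin

text \<open>
  Undirected simple graphs are the \<^locale>\<open>pair_graph\<close>s of the graph library, i.e. finite symmetric
  loop-free relations. Since matrices are indexed from 0, the vertices of a graph on n vertices are
  0, ..., n - 1.
\<close>

definition adj_mat :: "nat pair_pre_digraph \<Rightarrow> real mat" where
  "adj_mat G = mat (card (pverts G)) (card (pverts G))
     (\<lambda>(i, j). if (i, j) \<in> parcs G then 1 else 0)"

definition aut_group :: "'a pair_pre_digraph \<Rightarrow> ('a \<Rightarrow> 'a) monoid" where
  "aut_group G =
    \<lparr>carrier = {p. p permutes pverts G \<and>
        (\<forall>x\<in>pverts G. \<forall>y\<in>pverts G. (p x, p y) \<in> parcs G \<longleftrightarrow> (x, y) \<in> parcs G)},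
     monoid.mult = (\<circ>), one = id\<rparr>"

definition orbitals :: "'a pair_pre_digraph \<Rightarrow> ('a \<times> 'a) set set" where
  "orbitals G = orbits (aut_group G)
     {(x, y). x \<in> pverts G \<and> y \<in> pverts G \<and> x \<noteq> y} (\<lambda>p. map_prod p p)"

definition perm_mats :: "nat \<Rightarrow> real mat set" where
  "perm_mats n =
    {mat n n (\<lambda>(i, j). if i = p j then 1 else 0) | p. p permutes {0..<n}}"

definition ones_mat :: "nat \<Rightarrow> nat \<Rightarrow> real mat" where
  "ones_mat p q = mat p q (\<lambda>_. 1)"

definition cut_mat :: "nat \<Rightarrow> nat \<Rightarrow> nat \<Rightarrow> real mat" where
  "cut_mat m1 m2 m3 =
    four_block_mat
      (four_block_mat (0\<^sub>m m1 m1) (ones_mat m1 m2) (ones_mat m2 m1) (0\<^sub>m m2 m2))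
      (0\<^sub>m (m1 + m2) m3)
      (0\<^sub>m m3 (m1 + m2))
      (0\<^sub>m m3 m3)"

definition cut_graph :: "nat \<Rightarrow> nat \<Rightarrow> nat \<Rightarrow> nat pair_pre_digraph" where
  "cut_graph m1 m2 m3 =
    \<lparr>pverts = {0..<m1 + m2 + m3},
     parcs = {(i, j). i < m1 + m2 + m3 \<and> j < m1 + m2 + m3 \<and> cut_mat m1 m2 m3 $$ (i, j) = 1}\<rparr>"

definition trace_mat :: "'a::comm_monoid_add mat \<Rightarrow> 'a" where
  "trace_mat M = (\<Sum>i<dim_row M. M $$ (i, i))"

lemma group_aut_group: "group (aut_group G)"
proof (rule groupI)
  fix p q assume "p \<in> carrier (aut_group G)" "q \<in> carrier (aut_group G)"
  then show "p \<otimes>\<^bsub>aut_group G\<^esub> q \<in> carrier (aut_group G)"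
    by (auto simp: aut_group_def permutes_compose permutes_in_image)
next
  fix p assume "p \<in> carrier (aut_group G)"
  then have p: "p permutes pverts G"
    and e: "\<forall>x\<in>pverts G. \<forall>y\<in>pverts G. (p x, p y) \<in> parcs G \<longleftrightarrow> (x, y) \<in> parcs G"
    by (auto simp: aut_group_def)
  have i: "inv_into UNIV p permutes pverts G" by (rule permutes_inv[OF p])
  have "inv_into UNIV p \<in> carrier (aut_group G)"
    unfolding aut_group_def
    using e i permutes_in_image[OF i] permutes_inverses[OF p]
    by simp metis
  moreover have "inv_into UNIV p \<circ> p = id" by (rule permutes_inv_o(2)[OF p])
  ultimately show "\<exists>q\<in>carrier (aut_group G). q \<otimes>\<^bsub>aut_group G\<^esub> p = \<one>\<^bsub>aut_group G\<^esub>"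
    by (auto simp: aut_group_def)
qed (auto simp: aut_group_def comp_assoc permutes_id)

lemma cut_mat_index:
  assumes "i < m1 + m2 + m3" "j < m1 + m2 + m3"
  shows "cut_mat m1 m2 m3 $$ (i, j) =
    (if i < m1 \<and> m1 \<le> j \<and> j < m1 + m2 \<or> j < m1 \<and> m1 \<le> i \<and> i < m1 + m2 then 1 else 0)"
  using assms by (auto simp: cut_mat_def ones_mat_def)

lemma pair_graph_cut_graph: "pair_graph (cut_graph m1 m2 m3)"
proof
  have "parcs (cut_graph m1 m2 m3) \<subseteq> {0..<m1 + m2 + m3} \<times> {0..<m1 + m2 + m3}"
    by (auto simp: cut_graph_def)
  then show "finite (parcs (cut_graph m1 m2 m3))"
    by (rule finite_subset) simp
  show "symmetric (with_proj (cut_graph m1 m2 m3))"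
    unfolding symmetric_def arcs_ends_def arc_to_ends_def
    by (rule symI) (auto simp: cut_graph_def cut_mat_index split: if_splits)
qed (auto simp: cut_graph_def cut_mat_index split: if_splits)

lemma adj_mat_cut_graph: "adj_mat (cut_graph m1 m2 m3) = cut_mat m1 m2 m3"
proof (rule eq_matI)
  fix i j assume "i < dim_row (cut_mat m1 m2 m3)" "j < dim_col (cut_mat m1 m2 m3)"
  then have "i < m1 + m2 + m3" "j < m1 + m2 + m3"
    by (auto simp: cut_mat_def ones_mat_def)
  then show "adj_mat (cut_graph m1 m2 m3) $$ (i, j) = cut_mat m1 m2 m3 $$ (i, j)"
    by (auto simp: adj_mat_def cut_graph_def cut_mat_index)
qed (auto simp: adj_mat_def cut_graph_def cut_mat_def ones_mat_def)

text \<open>The following facts ensure that all minima over sets of permutation matrices exist.\<close>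

lemma finite_perm_mats: "finite (perm_mats n)"
  unfolding perm_mats_def
  by (rule finite_image_set) (rule finite_permutations, simp)

lemma perm_mats_fixing_nonempty:
  assumes "r1 < n" "r2 < n" "r1 \<noteq> r2" "s1 < n" "s2 < n" "s1 \<noteq> s2"
  shows "{X \<in> perm_mats n. X $$ (r1, s1) = 1 \<and> X $$ (r2, s2) = 1} \<noteq> {}"
proof -
  define q where "q = transpose s1 r1"
  define p where "p = transpose (q s2) r2 \<circ> q"
  have q: "q permutes {0..<n}"
    using assms by (auto simp: q_def intro: permutes_swap_id)
  then have "q s2 \<in> {0..<n}"
    using assms by (simp only: permutes_in_image) simp
  then have p: "p permutes {0..<n}"
    unfolding p_def using assms q by (intro permutes_compose permutes_swap_id) auto
  have "q s1 = r1" by (simp add: q_def)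
  moreover have "q s2 \<noteq> q s1"
    using assms permutes_inj[OF q] by (auto dest: injD)
  ultimately have "p s1 = r1" "p s2 = r2"
    using assms by (auto simp: p_def transpose_def)
  moreover have "mat n n (\<lambda>(i, j). if i = p j then 1 else 0) \<in> perm_mats n"
    using p by (auto simp: perm_mats_def)
  ultimately show ?thesis
    using assms
    by (auto simp: set_eq_iff intro!: exI[of _ "mat n n (\<lambda>(i, j). if i = p j then 1 else 0)"])
qed

end

theory Submission
  imports Defs
begin

text \<open>
  For the matrix X of a permutation p, with its ones at the positions \<open>(p j, j)\<close>, the matrix \<open>X\<^sup>T A X\<close> has the entries \<open>A (p i, p j)\<close>, so the
  objective depends on p only up to composing it on the left with an automorphism of G
  (\<open>conjugate_perm_mat_automorphism\<close>). An arbitrary X sends the pair \<open>(s1, s2)\<close> of distinct vertices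
  to the pair \<open>(p s1, p s2)\<close> of distinct vertices, which lies in some orbital. By definition of an
  orbital, an automorphism g carries this pair to the chosen representative of that orbital. The
  matrix of \<open>g \<circ> p\<close> therefore belongs to the set restricted by that representative and has the same
  objective value as X (\<open>move_pair_within_orbital\<close>). Hence the restricted sets together attain
  every value of the objective, in particular the least one.
\<close>

definition perm_mat :: "nat \<Rightarrow> (nat \<Rightarrow> nat) \<Rightarrow> real mat" where
  "perm_mat n p = mat n n (\<lambda>(i, j). if i = p j then 1 else 0)"

lemma perm_mats_eq: "perm_mats n = {perm_mat n p | p. p permutes {0..<n}}"
  by (simp add: perm_mats_def perm_mat_def)

lemma perm_mat_index_eq_1_iff:
  assumes "i < n" "j < n"
  shows "perm_mat n p $$ (i, j) = 1 \<longleftrightarrow> i = p j"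
  using assms by (simp add: perm_mat_def)

lemma conjugate_perm_mat:
  assumes p: "p permutes {0..<n}" and A: "A \<in> carrier_mat n n"
  shows "transpose_mat (perm_mat n p) * A * perm_mat n p = mat n n (\<lambda>(i, j). A $$ (p i, p j))"
proof (rule eq_matI)
  let ?C = "mat n n (\<lambda>(i, j). A $$ (p i, p j))"
  fix i j assume "i < dim_row ?C" "j < dim_col ?C"
  then have ij: "i < n" "j < n" by auto
  have lt: "p k < n" if "k < n" for k
    using permutes_in_image[OF p, of k] that by simp
  have row: "(transpose_mat (perm_mat n p) * A) $$ (i, k) = A $$ (p i, k)" if "k < n" for k
    using that ij A lt[of i] by (simp add: perm_mat_def scalar_prod_def of_bool_def[symmetric])
  have "(transpose_mat (perm_mat n p) * A * perm_mat n p) $$ (i, j) =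
      (\<Sum>k\<in>{0..<n}. (transpose_mat (perm_mat n p) * A) $$ (i, k) * perm_mat n p $$ (k, j))"
    using ij A by (simp add: perm_mat_def scalar_prod_def)
  also have "\<dots> = (\<Sum>k\<in>{0..<n}. if k = p j then A $$ (p i, k) else 0)"
    using row ij by (intro sum.cong) (auto simp: perm_mat_def)
  also have "\<dots> = A $$ (p i, p j)"
    using lt[of j] ij by simp
  finally show "(transpose_mat (perm_mat n p) * A * perm_mat n p) $$ (i, j) = ?C $$ (i, j)"
    using ij by simp
qed (use A in \<open>auto simp: perm_mat_def\<close>)

lemma conjugate_perm_mat_automorphism:
  assumes verts: "pverts G = {0..<n}" and g: "g \<in> carrier (aut_group G)"
    and p: "p permutes {0..<n}"
  shows "transpose_mat (perm_mat n (g \<circ> p)) * adj_mat G * perm_mat n (g \<circ> p) =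
    transpose_mat (perm_mat n p) * adj_mat G * perm_mat n p"
proof -
  have A: "adj_mat G \<in> carrier_mat n n"
    by (simp add: adj_mat_def verts)
  have gp: "g permutes {0..<n}"
    and g_arcs: "\<forall>x\<in>{0..<n}. \<forall>y\<in>{0..<n}. (g x, g y) \<in> parcs G \<longleftrightarrow> (x, y) \<in> parcs G"
    using g verts by (auto simp: aut_group_def)
  have lt: "p k < n" "g (p k) < n" if "k < n" for k
    using permutes_in_image[OF p, of k] permutes_in_image[OF gp, of "p k"] that by simp_all
  have "mat n n (\<lambda>(i, j). adj_mat G $$ ((g \<circ> p) i, (g \<circ> p) j)) =
      mat n n (\<lambda>(i, j). adj_mat G $$ (p i, p j))"
    using lt g_arcs by (intro cong_mat) (simp_all add: adj_mat_def verts)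
  then show ?thesis
    by (simp only: conjugate_perm_mat[OF permutes_compose[OF p gp] A] conjugate_perm_mat[OF p A])
qed

lemma orbital_pairD:
  assumes "O' \<in> orbitals G" "(x, y) \<in> O'"
  shows "x \<in> pverts G" "y \<in> pverts G" "x \<noteq> y"
proof -
  obtain g a b where g: "g permutes pverts G" and ab: "a \<in> pverts G" "b \<in> pverts G" "a \<noteq> b"
    and xy: "x = g a" "y = g b"
    using assms by (auto simp: orbitals_def orbits_def orbit_def aut_group_def)
  show "x \<in> pverts G" "y \<in> pverts G" "x \<noteq> y"
    using ab permutes_in_image[OF g] permutes_inj[OF g] by (auto simp: xy dest: injD)
qed

lemma pair_in_some_orbital:
  assumes "x \<in> pverts G" "y \<in> pverts G" "x \<noteq> y"
  obtains O' where "O' \<in> orbitals G"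
    "\<And>a b. (a, b) \<in> O' \<Longrightarrow> \<exists>g\<in>carrier (aut_group G). g x = a \<and> g y = b"
proof (rule that)
  let ?O = "orbit (aut_group G) (\<lambda>p. map_prod p p) (x, y)"
  show "?O \<in> orbitals G"
    using assms by (auto simp: orbitals_def orbits_def)
  show "\<exists>g\<in>carrier (aut_group G). g x = a \<and> g y = b" if "(a, b) \<in> ?O" for a b
    using that by (auto simp: orbit_def)
qed

text \<open>
  This is where the automorphisms of G are put to use: prescribing where \<open>(s1, s2)\<close> goes costs nothing,
  as long as every orbital offers a target.
\<close>

lemma move_pair_within_orbital:
  assumes verts: "pverts G = {0..<n}" and X: "X \<in> perm_mats n"
    and s: "s1 < n" "s2 < n" "s1 \<noteq> s2"
  obtains O' where "O' \<in> orbitals G"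
    "\<And>a b. (a, b) \<in> O' \<Longrightarrow> \<exists>Y\<in>perm_mats n. Y $$ (a, s1) = 1 \<and> Y $$ (b, s2) = 1 \<and>
      transpose_mat Y * adj_mat G * Y = transpose_mat X * adj_mat G * X"
proof -
  obtain p where p: "p permutes {0..<n}" and Xp: "X = perm_mat n p"
    using X by (auto simp: perm_mats_eq)
  have "p s1 \<in> pverts G" "p s2 \<in> pverts G"
    using s permutes_in_image[OF p] verts by auto
  moreover have "p s1 \<noteq> p s2"
    using s permutes_inj[OF p] by (auto dest: injD)
  ultimately obtain O' where O': "O' \<in> orbitals G"
    and carry: "\<And>a b. (a, b) \<in> O' \<Longrightarrow> \<exists>g\<in>carrier (aut_group G). g (p s1) = a \<and> g (p s2) = b"
    by (rule pair_in_some_orbital) metis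
  show thesis
  proof (rule that[OF O'])
    fix a b assume ab: "(a, b) \<in> O'"
    then obtain g where g: "g \<in> carrier (aut_group G)" "g (p s1) = a" "g (p s2) = b"
      using carry by blast
    have "(g \<circ> p) permutes {0..<n}"
      using g(1) p verts by (auto simp: aut_group_def intro: permutes_compose)
    moreover have "a < n" "b < n"
      using orbital_pairD[OF O' ab] verts by auto
    ultimately show "\<exists>Y\<in>perm_mats n. Y $$ (a, s1) = 1 \<and> Y $$ (b, s2) = 1 \<and>
        transpose_mat Y * adj_mat G * Y = transpose_mat X * adj_mat G * X"
      using s g conjugate_perm_mat_automorphism[OF verts g(1) p]
      by (intro bexI[of _ "perm_mat n (g \<circ> p)"])
        (auto simp: perm_mats_eq Xp perm_mat_index_eq_1_iff)
  qed
qed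

lemma Min_eq_Min_Min:
  fixes f :: "'a \<Rightarrow> 'b::linorder"
  assumes "finite S" "S \<noteq> {}" "finite I"
    and sub: "\<And>h. h \<in> I \<Longrightarrow> T h \<subseteq> S" and ne: "\<And>h. h \<in> I \<Longrightarrow> T h \<noteq> {}"
    and cover: "\<And>x. x \<in> S \<Longrightarrow> \<exists>h\<in>I. \<exists>y\<in>T h. f y = f x"
  shows "(MIN x\<in>S. f x) = (MIN h\<in>I. MIN x\<in>T h. f x)"
proof -
  have fin: "finite (T h)" if "h \<in> I" for h
    using sub[OF that] \<open>finite S\<close> by (rule finite_subset)
  have "I \<noteq> {}"
    using \<open>S \<noteq> {}\<close> cover by blast
  show ?thesis
  proof (rule antisym)
    show "(MIN x\<in>S. f x) \<le> (MIN h\<in>I. MIN x\<in>T h. f x)"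
      using \<open>I \<noteq> {}\<close> \<open>finite I\<close> \<open>finite S\<close> sub ne by (auto intro!: Min.boundedI Min_antimono)
    have "(MIN x\<in>S. f x) \<in> f ` S"
      using \<open>finite S\<close> \<open>S \<noteq> {}\<close> by (intro Min_in) auto
    then obtain h y where hy: "h \<in> I" "y \<in> T h" "(MIN x\<in>S. f x) = f y"
      using cover by (metis imageE)
    have "(MIN h\<in>I. MIN x\<in>T h. f x) \<le> (MIN x\<in>T h. f x)"
      using \<open>finite I\<close> hy(1) by (intro Min_le) auto
    also have "\<dots> \<le> f y"
      using fin hy by (intro Min_le) auto
    finally show "(MIN h\<in>I. MIN x\<in>T h. f x) \<le> (MIN x\<in>S. f x)"
      by (simp only: hy(3))
  qed
qed

theorem theorem2:
  fixes G :: "nat pair_pre_digraph"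
    and n m1 m2 m3 t s1 s2 :: nat
    and A B :: "real mat"
    and orb :: "nat \<Rightarrow> (nat \<times> nat) set"
    and r1 r2 :: "nat \<Rightarrow> nat"
  assumes "pair_graph G" and "pverts G = {0..<n}"
    and "A = adj_mat G"
    and "bij_betw orb {1..t} (orbitals G)"
    and "m1 \<ge> 1" and "m2 \<ge> 1" and "m1 + m2 + m3 = n"
    and "B = cut_mat m1 m2 m3"
    and "(s1, s2) \<in> parcs (cut_graph m1 m2 m3)"
    and "\<And>h. h \<in> {1..t} \<Longrightarrow> (r1 h, r2 h) \<in> orb h"
  shows "(MIN X\<in>perm_mats n. trace_mat (transpose_mat X * A * X * B)) =
    (MIN h\<in>{1..t}. MIN X\<in>{X \<in> perm_mats n. X $$ (r1 h, s1) = 1 \<and> X $$ (r2 h, s2) = 1}.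
       trace_mat (transpose_mat X * A * X * B))"
proof (rule Min_eq_Min_Min)
  have s: "s1 < n" "s2 < n" "s1 \<noteq> s2"
    using assms(7,9) by (auto simp: cut_graph_def cut_mat_index split: if_splits)
  show "finite (perm_mats n)"
    by (rule finite_perm_mats)
  show "perm_mats n \<noteq> {}"
    using permutes_id[of "{0..<n}"] by (auto simp: perm_mats_def intro: exI[of _ id])
  show "{X \<in> perm_mats n. X $$ (r1 h, s1) = 1 \<and> X $$ (r2 h, s2) = 1} \<noteq> {}" if h: "h \<in> {1..t}" for h
  proof -
    have "orb h \<in> orbitals G"
      using assms(4) h by (rule bij_betw_apply)
    then have "r1 h < n" "r2 h < n" "r1 h \<noteq> r2 h"
      using orbital_pairD[OF _ assms(10)[OF h]] assms(2) by auto
    then show ?thesis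
      using s by (intro perm_mats_fixing_nonempty)
  qed
  fix X assume X: "X \<in> perm_mats n"
  obtain O' where O': "O' \<in> orbitals G"
    and move: "\<And>a b. (a, b) \<in> O' \<Longrightarrow> \<exists>Y\<in>perm_mats n. Y $$ (a, s1) = 1 \<and> Y $$ (b, s2) = 1 \<and>
      transpose_mat Y * adj_mat G * Y = transpose_mat X * adj_mat G * X"
    by (rule move_pair_within_orbital[OF assms(2) X s]) metis
  obtain h where h: "h \<in> {1..t}" "orb h = O'"
    using O' bij_betw_imp_surj_on[OF assms(4)] by (metis imageE)
  then obtain Y where "Y \<in> perm_mats n" "Y $$ (r1 h, s1) = 1" "Y $$ (r2 h, s2) = 1"
    "transpose_mat Y * A * Y = transpose_mat X * A * X"
    using move[of "r1 h" "r2 h"] assms(3,10) by blast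
  then show "\<exists>h\<in>{1..t}. \<exists>Y\<in>{X \<in> perm_mats n. X $$ (r1 h, s1) = 1 \<and> X $$ (r2 h, s2) = 1}.
      trace_mat (transpose_mat Y * A * Y * B) = trace_mat (transpose_mat X * A * X * B)"
    using h(1) by (intro bexI[of _ h] bexI[of _ Y]) simp_all
qed auto

end
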